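(* Let $G$ be a finite simple graph on the vertex set $[n]$ without isolated vertices, let $K$ be a field and $S=K[x_1,\dots,x_n]$. Then $$I_c(G)\ =\ \Big(\bigcap_{e\in E(G^c)}P_e\Big)\cap\Big(\bigcap_{T\in\mathcal{T}(G)}P_T\Big).$$
   Context: $[n]=\{1,\dots,n\}$. For a finite simple graph $G$ with vertex set $V(G)=[n]$ and edge set $E(G)$, the complementary edge ideal of $G$ is $I_c(G)=\big((x_1\cdots x_n)/(x_ix_j) : \{i,j\}\in E(G)\big)\subset S$. $G^c$ is the complementary graph: same vertex set, with edges exactly the pairs $\{i,j\}$, $i\neq j$, not in $E(G)$. $\mathcal{T}(G)$ is the set of triangles of $G$, i.e. of 3-element subsets of $[n]$ any two of whose elements are adjacent in $G$. For non-empty $F\subset[n]$, $P_F=(x_i : i\in F)$. An empty intersection of ideals is $S$. *)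

theory Defs
  imports "HOL-Library.Poly_Mapping" "HOL-Algebra.Ideal"
begin

text \<open>A polynomial is a finitely supported map from exponent vectors to coefficients, so the type
  below has variables \<open>x\<^sub>i\<close> for all \<open>i :: nat\<close>; \<open>K[x\<^sub>1, \<dots>, x\<^sub>n]\<close> is carved out of it by the
  carrier of \<open>poly_ring n\<close>.\<close>

type_synonym 'k mpol = "(nat \<Rightarrow>\<^sub>0 nat) \<Rightarrow>\<^sub>0 'k"

definition indet :: "nat \<Rightarrow> 'k::field mpol" where
  "indet i = Poly_Mapping.single (Poly_Mapping.single i 1) 1"

definition poly_ring :: "nat \<Rightarrow> 'k::field mpol ring" where
  "poly_ring n = \<lparr>carrier = {p. \<forall>m\<in>Poly_Mapping.keys p. Poly_Mapping.keys m \<subseteq> {1..n}},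
     mult = (*), one = 1, zero = 0, add = (+)\<rparr>"

lemma poly_ring_simps [simp]:
  "carrier (poly_ring n) = {p. \<forall>m\<in>Poly_Mapping.keys p. Poly_Mapping.keys m \<subseteq> {1..n}}"
  "mult (poly_ring n) = (*)" "one (poly_ring n) = 1"
  "zero (poly_ring n) = 0" "add (poly_ring n) = (+)"
  by (simp_all add: poly_ring_def)

lemma cring_poly_ring: "cring (poly_ring n :: 'k::field mpol ring)"
proof (rule cringI)
  show "abelian_group (poly_ring n :: 'k mpol ring)"
  proof (rule abelian_groupI)
    fix p q :: "'k mpol"
    assume "p \<in> carrier (poly_ring n)" "q \<in> carrier (poly_ring n)"
    then show "p \<oplus>\<^bsub>poly_ring n\<^esub> q \<in> carrier (poly_ring n)"
      using keys_add [of p q] by fastforce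
  next
    fix p :: "'k mpol"
    assume "p \<in> carrier (poly_ring n)"
    moreover have "Poly_Mapping.keys (- p) = Poly_Mapping.keys p"
      by (auto simp: in_keys_iff)
    ultimately show "\<exists>q\<in>carrier (poly_ring n). q \<oplus>\<^bsub>poly_ring n\<^esub> p = \<zero>\<^bsub>poly_ring n\<^esub>"
      by (intro bexI [of _ "- p"]) auto
  qed (auto simp: algebra_simps)
  show "comm_monoid (poly_ring n :: 'k mpol ring)"
  proof (rule comm_monoidI)
    fix p q :: "'k mpol"
    assume pq: "p \<in> carrier (poly_ring n)" "q \<in> carrier (poly_ring n)"
    show "p \<otimes>\<^bsub>poly_ring n\<^esub> q \<in> carrier (poly_ring n)"
      unfolding poly_ring_simps mem_Collect_eq
    proof
      fix m assume "m \<in> Poly_Mapping.keys (p * q)"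
      then obtain a b where "m = a + b" "a \<in> Poly_Mapping.keys p" "b \<in> Poly_Mapping.keys q"
        using keys_mult [of p q] by blast
      then show "Poly_Mapping.keys m \<subseteq> {1..n}"
        using pq keys_add [of a b] by fastforce
    qed
  qed (auto simp: algebra_simps)
qed (auto simp: algebra_simps)

text \<open>A simple graph on \<open>{1..n}\<close> is given by its set of edges.\<close>

definition simple_graph :: "nat \<Rightarrow> nat set set \<Rightarrow> bool" where
  "simple_graph n E \<longleftrightarrow> E \<subseteq> {e. e \<subseteq> {1..n} \<and> card e = 2}"

definition no_isolated_vertices :: "nat \<Rightarrow> nat set set \<Rightarrow> bool" where
  "no_isolated_vertices n E \<longleftrightarrow> (\<forall>i\<in>{1..n}. \<exists>j\<in>{1..n}. {i, j} \<in> E)"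

definition compl_edges :: "nat \<Rightarrow> nat set set \<Rightarrow> nat set set" where
  "compl_edges n E = {{i, j} | i j. i \<in> {1..n} \<and> j \<in> {1..n} \<and> i \<noteq> j \<and> {i, j} \<notin> E}"

definition triangles :: "nat \<Rightarrow> nat set set \<Rightarrow> nat set set" where
  "triangles n E = {T. T \<subseteq> {1..n} \<and> card T = 3 \<and> (\<forall>i\<in>T. \<forall>j\<in>T. i \<noteq> j \<longrightarrow> {i, j} \<in> E)}"

text \<open>\<open>compl_monom n e\<close> is \<open>(x\<^sub>1 \<cdots> x\<^sub>n) / (x\<^sub>i x\<^sub>j)\<close> for \<open>e = {i, j}\<close>; the quotient is
  characterised by \<open>compl_monom_quotient\<close>.\<close>

definition compl_monom :: "nat \<Rightarrow> nat set \<Rightarrow> 'k::field mpol" where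
  "compl_monom n e = (\<Prod>k\<in>{1..n} - e. indet k)"

lemma compl_monom_quotient:
  assumes "i \<in> {1..n}" "j \<in> {1..n}" "i \<noteq> j"
  shows "p * (indet i * indet j) = (\<Prod>k\<in>{1..n}. indet k :: 'k::field mpol)
    \<longleftrightarrow> p = compl_monom n {i, j}"
proof -
  have eq: "(\<Prod>k\<in>{1..n}. indet k :: 'k mpol) = compl_monom n {i, j} * (indet i * indet j)"
    using assms prod.subset_diff [of "{i, j}" "{1..n}" "indet :: nat \<Rightarrow> 'k mpol"]
    by (simp add: compl_monom_def)
  have "indet k \<noteq> (0 :: 'k mpol)" for k
    using keys_single [of "Poly_Mapping.single k (1::nat)" "1::'k"] 
    by (metis indet_def insert_not_empty keys_zero zero_neq_one)
  then show ?thesis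
    unfolding eq by simp
qed

definition compl_edge_ideal :: "nat \<Rightarrow> nat set set \<Rightarrow> 'k::field mpol set" where
  "compl_edge_ideal n E = Idl\<^bsub>poly_ring n\<^esub> (compl_monom n ` E)"

definition var_ideal :: "nat \<Rightarrow> nat set \<Rightarrow> 'k::field mpol set" where
  "var_ideal n F = Idl\<^bsub>poly_ring n\<^esub> (indet ` F)"

text \<open>Intersection of a family of ideals of \<open>R\<close>; that of the empty family is \<open>R\<close>,
  not \<^term>\<open>UNIV\<close>.\<close>

definition ideal_Inter :: "('a, 'b) ring_scheme \<Rightarrow> 'i set \<Rightarrow> ('i \<Rightarrow> 'a set) \<Rightarrow> 'a set" where
  "ideal_Inter R A I = carrier R \<inter> (\<Inter>a\<in>A. I a)"

end

theory Submission
  imports Defs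
begin

text \<open>All the ideals in question are generated by squarefree monomials \<open>x\<^sub>B = \<Prod>k\<in>B. x\<^sub>k\<close>: the ideal
  \<open>P\<^sub>F\<close> by those with \<open>B = {i}\<close>, \<open>i \<in> F\<close>, and \<open>I\<^sub>c(G)\<close> by those with \<open>B = [n] - e\<close>, \<open>e \<in> E(G)\<close>. A
  polynomial lies in an ideal generated by squarefree monomials iff the support of each of its
  monomials contains one of the sets \<open>B\<close> (lemma \<open>squarefree_monomial_ideal\<close>), so that the
  theorem is a statement about the sets \<open>W \<subseteq> [n]\<close> that occur as supports of monomials.

  Let \<open>U = [n] - W\<close> be the set of the variables that do not divide the monomial. On the left,
  the condition \<open>[n] - e \<subseteq> W\<close> says \<open>U \<subseteq> e\<close>. On the right, \<open>W\<close> has to meet every non-edge and every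
  triangle, that is, \<open>U\<close> contains neither a non-edge nor a triangle: it is a clique on at most
  two vertices. A clique on two vertices is an edge, and a smaller set lies in an edge because
  the graph is not empty and has no isolated vertices (lemma \<open>subset_edge_iff\<close>).\<close>

section \<open>Ideals generated by squarefree monomials\<close>

lemma prod_indet:
  assumes "finite B"
  shows "(\<Prod>k\<in>B. indet k :: 'k::field mpol)
    = Poly_Mapping.single (\<Sum>k\<in>B. Poly_Mapping.single k 1) 1"
  using assms by (induction rule: finite_induct) (simp_all add: indet_def mult_single)

lemma lookup_sum_single_one:
  assumes "finite B"
  shows "Poly_Mapping.lookup (\<Sum>k\<in>B. Poly_Mapping.single k (1::nat)) i = (if i \<in> B then 1 else 0)"
  using assms by (simp add: lookup_sum lookup_single when_def)

lemma keys_sum_single_one: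
  assumes "finite B"
  shows "Poly_Mapping.keys (\<Sum>k\<in>B. Poly_Mapping.single k (1::nat)) = B"
  unfolding set_eq_iff in_keys_iff lookup_sum_single_one [OF assms] by simp

lemma sum_monomials:
  fixes p :: "'a \<Rightarrow>\<^sub>0 'b::comm_monoid_add"
  shows "p = (\<Sum>m\<in>Poly_Mapping.keys p. Poly_Mapping.single m (Poly_Mapping.lookup p m))"
  by (rule poly_mapping_eqI) (auto simp: lookup_sum lookup_single when_def in_keys_iff)

text \<open>Each monomial of a sum occurs in one of the summands, so a condition on single monomials is
  preserved by addition. This one is also preserved by multiplication with a polynomial, because
  the support of a product of monomials is the union of their supports.\<close>

lemma ideal_of_support_condition:
  "ideal {p \<in> carrier (poly_ring n). \<forall>m\<in>Poly_Mapping.keys p. \<exists>B\<in>X. B \<subseteq> Poly_Mapping.keys m}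
    (poly_ring n :: 'k::field mpol ring)"
  (is "ideal ?J ?R")
proof -
  interpret cring ?R by (rule cring_poly_ring)
  have keys_plus: "Poly_Mapping.keys (a + b) = Poly_Mapping.keys a \<union> Poly_Mapping.keys b"
    for a b :: "nat \<Rightarrow>\<^sub>0 nat"
    by (auto simp: in_keys_iff lookup_add)
  have mult: "x * a \<in> ?J" if a: "a \<in> ?J" and x: "x \<in> carrier ?R" for a x
  proof -
    have "a \<in> carrier ?R"
      using a by blast
    from m_closed [OF x this] have "x * a \<in> carrier ?R"
      unfolding poly_ring_simps(2) .
    moreover have "\<exists>B\<in>X. B \<subseteq> Poly_Mapping.keys m" if m: "m \<in> Poly_Mapping.keys (x * a)" for m
    proof -
      obtain u v where uv: "m = u + v" "v \<in> Poly_Mapping.keys a"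
        using m keys_mult [of x a] by blast
      with a obtain B where "B \<in> X" "B \<subseteq> Poly_Mapping.keys v"
        by blast
      then show ?thesis unfolding uv(1) keys_plus by blast
    qed
    ultimately show ?thesis by blast
  qed
  have inv: "\<ominus>\<^bsub>?R\<^esub> a \<in> ?J" if a: "a \<in> ?J" for a
  proof -
    have k: "Poly_Mapping.keys (- a) = Poly_Mapping.keys a"
      by (auto simp: in_keys_iff)
    with a have neg: "- a \<in> ?J" unfolding poly_ring_simps by simp
    have "\<ominus>\<^bsub>?R\<^esub> a = - a"
    proof (rule minus_equality)
      show "- a \<oplus>\<^bsub>?R\<^esub> a = \<zero>\<^bsub>?R\<^esub>" by simp
      show "a \<in> carrier ?R" using a by blast
      show "- a \<in> carrier ?R" using neg by blast
    qed
    with neg show ?thesis by (simp only:)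
  qed
  have "subgroup ?J (add_monoid ?R)"
  proof (rule add.subgroupI)
    show "?J \<subseteq> carrier ?R" by blast
    have "0 \<in> ?J" by simp
    then show "?J \<noteq> {}" by blast
    show "\<ominus>\<^bsub>?R\<^esub> a \<in> ?J" if "a \<in> ?J" for a
      by (rule inv [OF that])
    show "a \<oplus>\<^bsub>?R\<^esub> b \<in> ?J" if "a \<in> ?J" "b \<in> ?J" for a b
    proof -
      have "a \<oplus>\<^bsub>?R\<^esub> b \<in> carrier ?R"
        using that by (intro a_closed) blast+
      moreover have "\<exists>B\<in>X. B \<subseteq> Poly_Mapping.keys m" if "m \<in> Poly_Mapping.keys (a + b)" for m
        using \<open>a \<in> ?J\<close> \<open>b \<in> ?J\<close> that keys_add [of a b] by blast
      ultimately show ?thesis by simp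
    qed
  qed
  then show ?thesis
  proof (rule idealI [OF ring_axioms])
    show "x \<otimes>\<^bsub>?R\<^esub> a \<in> ?J" if "a \<in> ?J" "x \<in> carrier ?R" for a x
      using mult [OF that] unfolding poly_ring_simps(2) .
    show "a \<otimes>\<^bsub>?R\<^esub> x \<in> ?J" if "a \<in> ?J" "x \<in> carrier ?R" for a x
      using mult [OF that] unfolding poly_ring_simps(2) mult.commute [of a x] .
  qed
qed

text \<open>A monomial whose support contains \<open>B\<close> is a multiple of \<open>x\<^sub>B\<close>, and a polynomial is the sum
  of its monomials; this gives one inclusion, and the minimality of the generated ideal gives
  the other.\<close>

lemma squarefree_monomial_ideal:
  assumes X: "\<And>B. B \<in> X \<Longrightarrow> B \<subseteq> {1..n}"
  shows "Idl\<^bsub>poly_ring n\<^esub> ((\<lambda>B. \<Prod>k\<in>B. indet k :: 'k::field mpol) ` X)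
    = {p \<in> carrier (poly_ring n). \<forall>m\<in>Poly_Mapping.keys p. \<exists>B\<in>X. B \<subseteq> Poly_Mapping.keys m}"
  (is "?I = ?J")
proof
  let ?R = "poly_ring n :: 'k mpol ring"
  let ?e = "\<lambda>B. \<Sum>k\<in>B. Poly_Mapping.single k (1::nat)"
  let ?gens = "(\<lambda>B. \<Prod>k\<in>B. indet k :: 'k mpol) ` X"
  interpret cring ?R by (rule cring_poly_ring)
  have fin: "finite B" if "B \<in> X" for B
    using X [OF that] finite_subset by blast
  have gens: "?gens \<subseteq> ?J"
  proof
    fix p assume "p \<in> ?gens"
    then obtain B where B: "B \<in> X" "p = Poly_Mapping.single (?e B) 1"
      using fin by (auto simp: prod_indet)
    then show "p \<in> ?J"
      using X keys_sum_single_one [OF fin] by (auto split: if_splits)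
  qed
  show "?I \<subseteq> ?J"
    by (rule genideal_minimal [OF ideal_of_support_condition gens])
  interpret I: ideal ?I ?R
    using gens by (intro genideal_ideal) blast
  have gen_mem: "Poly_Mapping.single (?e B) 1 \<in> ?I" if "B \<in> X" for B
  proof -
    have "?gens \<subseteq> ?I"
      by (rule genideal_self) (use gens in blast)
    moreover have "Poly_Mapping.single (?e B) 1 \<in> ?gens"
      using that by (auto simp: prod_indet [OF fin] intro!: rev_image_eqI [OF that])
    ultimately show ?thesis by blast
  qed
  have monomial: "Poly_Mapping.single m c \<in> ?I"
    if m: "Poly_Mapping.keys m \<subseteq> {1..n}" and B: "B \<in> X" "B \<subseteq> Poly_Mapping.keys m"
    for m B and c :: 'k
  proof -
    \<comment> \<open>Subtraction of exponents is truncated; the equation holds because each \<open>k \<in> B\<close> has a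
      positive exponent in \<open>m\<close>.\<close>
    have "m = (m - ?e B) + ?e B"
    proof (rule poly_mapping_eqI)
      fix i
      show "Poly_Mapping.lookup m i = Poly_Mapping.lookup ((m - ?e B) + ?e B) i"
        unfolding lookup_add lookup_minus lookup_sum_single_one [OF fin [OF B(1)]]
        using B(2) by (auto simp: in_keys_iff subset_iff)
    qed
    then have "Poly_Mapping.single m c
        = Poly_Mapping.single (m - ?e B) c * Poly_Mapping.single (?e B) 1"
      by (simp add: mult_single)
    moreover have "Poly_Mapping.keys (m - ?e B) \<subseteq> {1..n}"
      using m by (auto simp: in_keys_iff lookup_minus)
    then have "Poly_Mapping.single (m - ?e B) c \<in> carrier ?R"
      by (auto split: if_splits)
    ultimately show ?thesis
      using I.I_l_closed [OF gen_mem [OF B(1)]] by simp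
  qed
  have sum_mem: "(\<Sum>m\<in>A. f m) \<in> ?I" if "finite A" "\<And>m. m \<in> A \<Longrightarrow> f m \<in> ?I"
    for A and f :: "(nat \<Rightarrow>\<^sub>0 nat) \<Rightarrow> 'k mpol"
    using that I.zero_closed I.a_closed
    by (induction A rule: finite_induct) simp_all
  show "?J \<subseteq> ?I"
  proof
    fix p assume p: "p \<in> ?J"
    have "(\<Sum>m\<in>Poly_Mapping.keys p. Poly_Mapping.single m (Poly_Mapping.lookup p m)) \<in> ?I"
    proof (rule sum_mem)
      fix m assume "m \<in> Poly_Mapping.keys p"
      with p obtain B where "Poly_Mapping.keys m \<subseteq> {1..n}" "B \<in> X" "B \<subseteq> Poly_Mapping.keys m"
        by auto
      then show "Poly_Mapping.single m (Poly_Mapping.lookup p m) \<in> ?I"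
        by (rule monomial)
    qed simp
    then show "p \<in> ?I"
      using sum_monomials [of p] by simp
  qed
qed

lemma compl_edge_ideal_iff:
  "p \<in> (compl_edge_ideal n E :: 'k::field mpol set) \<longleftrightarrow> p \<in> carrier (poly_ring n) \<and>
    (\<forall>m\<in>Poly_Mapping.keys p. \<exists>e\<in>E. {1..n} - e \<subseteq> Poly_Mapping.keys m)"
proof -
  have "compl_monom n ` E
      = (\<lambda>B. \<Prod>k\<in>B. indet k :: 'k mpol) ` ((\<lambda>e. {1..n} - e) ` E)"
    by (simp add: image_image compl_monom_def)
  then show ?thesis
    using squarefree_monomial_ideal [of "(\<lambda>e. {1..n} - e) ` E" n, where 'k = 'k]
    unfolding compl_edge_ideal_def by auto
qed

lemma var_ideal_iff:
  assumes "F \<subseteq> {1..n}"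
  shows "p \<in> (var_ideal n F :: 'k::field mpol set) \<longleftrightarrow> p \<in> carrier (poly_ring n) \<and>
    (\<forall>m\<in>Poly_Mapping.keys p. F \<inter> Poly_Mapping.keys m \<noteq> {})"
proof -
  have "indet ` F = (\<lambda>B. \<Prod>k\<in>B. indet k :: 'k mpol) ` ((\<lambda>i. {i}) ` F)"
    by (simp add: image_image)
  moreover have "Idl\<^bsub>poly_ring n\<^esub> ((\<lambda>B. \<Prod>k\<in>B. indet k :: 'k mpol) ` ((\<lambda>i. {i}) ` F))
    = {p \<in> carrier (poly_ring n).
        \<forall>m\<in>Poly_Mapping.keys p. \<exists>B\<in>(\<lambda>i. {i}) ` F. B \<subseteq> Poly_Mapping.keys m}"
    using assms by (intro squarefree_monomial_ideal) auto
  ultimately show ?thesis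
    unfolding var_ideal_def by auto
qed

section \<open>Sets of vertices contained in an edge\<close>

text \<open>A set \<open>U\<close> without non-edges is a clique, and any three of its elements would form a triangle;
  so \<open>U\<close> has at most two elements, and the cases of cardinality 0, 1 and 2 remain. An edge
  has two elements, hence it contains no triangle, and no non-edge because that would be
  equal to it.\<close>

lemma subset_edge_iff:
  assumes "n \<ge> 1" and G: "simple_graph n E" and noiso: "no_isolated_vertices n E"
    and U: "U \<subseteq> {1..n}"
  shows "(\<exists>e\<in>E. U \<subseteq> e) \<longleftrightarrow>
    (\<forall>F\<in>compl_edges n E. \<not> F \<subseteq> U) \<and> (\<forall>T\<in>triangles n E. \<not> T \<subseteq> U)"
proof
  assume "\<exists>e\<in>E. U \<subseteq> e"
  then obtain e where e: "e \<in> E" "U \<subseteq> e" by blast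
  with G have card_e: "card e = 2" by (auto simp: simple_graph_def)
  then have fin_e: "finite e" by (simp add: card_ge_0_finite)
  have "\<not> F \<subseteq> U" if F: "F \<in> compl_edges n E" for F
  proof
    assume "F \<subseteq> U"
    moreover have "card F = 2" "F \<notin> E"
      using F by (auto simp: compl_edges_def)
    ultimately show False
      using e card_e fin_e card_subset_eq [of e F] by auto
  qed
  moreover have "\<not> T \<subseteq> U" if "T \<in> triangles n E" for T
  proof
    assume "T \<subseteq> U"
    with e have "card T \<le> card e"
      using card_mono [OF fin_e, of T] by blast
    with that card_e show False by (simp add: triangles_def)
  qed
  ultimately show "(\<forall>F\<in>compl_edges n E. \<not> F \<subseteq> U) \<and> (\<forall>T\<in>triangles n E. \<not> T \<subseteq> U)"
    by blast
next
  assume avoid: "(\<forall>F\<in>compl_edges n E. \<not> F \<subseteq> U) \<and> (\<forall>T\<in>triangles n E. \<not> T \<subseteq> U)"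
  have clique: "{i, j} \<in> E" if "i \<in> U" "j \<in> U" "i \<noteq> j" for i j
  proof (rule ccontr)
    assume "{i, j} \<notin> E"
    with that U have "{i, j} \<in> compl_edges n E"
      unfolding compl_edges_def by blast
    with avoid have "\<not> {i, j} \<subseteq> U" by blast
    with that show False by simp
  qed
  have "\<not> card U \<ge> 3"
  proof
    assume "card U \<ge> 3"
    then obtain T where T: "T \<subseteq> U" "card T = 3"
      by (rule obtain_subset_with_card_n)
    then have "T \<in> triangles n E"
      using U clique unfolding triangles_def by blast
    with avoid T show False by blast
  qed
  then consider "card U = 0" | "card U = 1" | "card U = 2" by linarith
  then show "\<exists>e\<in>E. U \<subseteq> e"
  proof cases
    case 1
    then have "U = {}"
      using U finite_subset by fastforce
    moreover have "E \<noteq> {}"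
      using noiso \<open>n \<ge> 1\<close> unfolding no_isolated_vertices_def by auto
    ultimately show ?thesis by blast
  next
    case 2
    then obtain i where i: "U = {i}"
      by (rule card_1_singletonE)
    with U noiso obtain j where "{i, j} \<in> E"
      unfolding no_isolated_vertices_def by blast
    with i show ?thesis by blast
  next
    case 3
    then obtain i j where "U = {i, j}" "i \<noteq> j"
      unfolding card_2_iff by blast
    with clique have "U \<in> E" by blast
    then show ?thesis by blast
  qed
qed

section \<open>The intersection formula\<close>

theorem theorem2p1:
  fixes n :: nat and E :: "nat set set"
  assumes "n \<ge> 1"
    and "simple_graph n E"
    and "no_isolated_vertices n E"
  shows "(compl_edge_ideal n E :: 'k::field mpol set) =
    ideal_Inter (poly_ring n) (compl_edges n E) (var_ideal n) \<inter>
    ideal_Inter (poly_ring n) (triangles n E) (var_ideal n)"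
proof (rule Set.set_eqI)
  fix p :: "'k mpol"
  have sub: "F \<subseteq> {1..n}" if "F \<in> compl_edges n E \<union> triangles n E" for F
    using that by (auto simp: compl_edges_def triangles_def)
  have support: "(\<exists>e\<in>E. {1..n} - e \<subseteq> W) \<longleftrightarrow>
      (\<forall>F\<in>compl_edges n E \<union> triangles n E. F \<inter> W \<noteq> {})" for W
  proof -
    have "{1..n} - e \<subseteq> W \<longleftrightarrow> {1..n} - W \<subseteq> e" for e
      by blast
    moreover have "F \<inter> W \<noteq> {} \<longleftrightarrow> \<not> F \<subseteq> {1..n} - W"
      if "F \<in> compl_edges n E \<union> triangles n E" for F
      using sub [OF that] by blast
    ultimately show ?thesis
      using subset_edge_iff [OF assms, of "{1..n} - W"] by auto
  qed
  have "p \<in> compl_edge_ideal n E \<longleftrightarrow> p \<in> carrier (poly_ring n) \<and>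
      (\<forall>m\<in>Poly_Mapping.keys p. \<forall>F\<in>compl_edges n E \<union> triangles n E. F \<inter> Poly_Mapping.keys m \<noteq> {})"
    unfolding compl_edge_ideal_iff support ..
  also have "\<dots> \<longleftrightarrow> p \<in> carrier (poly_ring n) \<and>
      (\<forall>F\<in>compl_edges n E \<union> triangles n E. p \<in> var_ideal n F)"
    using var_ideal_iff [OF sub] by blast
  also have "\<dots> \<longleftrightarrow> p \<in> ideal_Inter (poly_ring n) (compl_edges n E) (var_ideal n) \<inter>
      ideal_Inter (poly_ring n) (triangles n E) (var_ideal n)"
    unfolding ideal_Inter_def by blast
  finally show "p \<in> compl_edge_ideal n E \<longleftrightarrow>
      p \<in> ideal_Inter (poly_ring n) (compl_edges n E) (var_ideal n) \<inter>
        ideal_Inter (poly_ring n) (triangles n E) (var_ideal n)" .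
qed

end
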